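(* Each quaternionic Möbius transformation $g(q)=(aq+b)\cdot(cq+d)^{-1}\in\mathbb{M}$ can be written uniquely as $$g(q)=\alpha\,(q-q_0)(1-\overline{q_0}\,q)^{-1}\beta^{-1}$$ where $q_0=-a^{-1}b\in\Delta_{\mathbb{H}}$ and where $\alpha=\dfrac{a}{|a|}\in\partial\Delta_{\mathbb{H}}$, $\beta=\dfrac{d}{|d|}\in\partial\Delta_{\mathbb{H}}$.
   Context: $\mathbb{H}$ is the skew field of real quaternions, $\Delta_{\mathbb{H}}=\{q\in\mathbb{H}:|q|<1\}$, and $\partial\Delta_{\mathbb{H}}=\{q\in\mathbb{H}:|q|=1\}$. A quaternionic fractional linear transformation is a map of $\mathbb{H}\cup\{\infty\}$ of the form $q\mapsto(aq+b)(cq+d)^{-1}$ with $\begin{bmatrix} a & b\\ c & d\end{bmatrix}$ an invertible $2\times 2$ matrix with quaternionic entries. $\mathbb{M}$, the group of (quaternionic) Möbius transformations, is the group of all quaternionic fractional linear transformations mapping $\Delta_{\mathbb{H}}$ onto itself.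
   Formalization: Uniqueness is proved up to replacing (α, β) by (−α, −β), with q_0 unique; literal uniqueness fails, since both sign choices always give the same g (e.g. g = id with α = β = 1 or α = β = −1). *)

theory Defs
  imports "HOL-Analysis.Analysis"
begin

datatype quat = Quat (re: real) (im_i: real) (im_j: real) (im_k: real)

lemma quat_eq_iff:
  "p = q \<longleftrightarrow> re p = re q \<and> im_i p = im_i q \<and> im_j p = im_j q \<and> im_k p = im_k q"
  by (metis quat.expand)

instantiation quat :: ring_1
begin

definition zero_quat where "0 = Quat 0 0 0 0"
definition one_quat where "1 = Quat 1 0 0 0"
definition plus_quat where
  "p + q = Quat (re p + re q) (im_i p + im_i q) (im_j p + im_j q) (im_k p + im_k q)"
definition minus_quat where
  "p - q = Quat (re p - re q) (im_i p - im_i q) (im_j p - im_j q) (im_k p - im_k q)"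
definition uminus_quat where
  "- p = Quat (- re p) (- im_i p) (- im_j p) (- im_k p)"
definition times_quat where
  "p * q = Quat
     (re p * re q - im_i p * im_i q - im_j p * im_j q - im_k p * im_k q)
     (re p * im_i q + im_i p * re q + im_j p * im_k q - im_k p * im_j q)
     (re p * im_j q - im_i p * im_k q + im_j p * re q + im_k p * im_i q)
     (re p * im_k q + im_i p * im_j q - im_j p * im_i q + im_k p * re q)"

instance
  by standard
    (auto simp: quat_eq_iff zero_quat_def one_quat_def plus_quat_def minus_quat_def
       uminus_quat_def times_quat_def algebra_simps)

end

instantiation quat :: real_vector
begin

definition scaleR_quat where
  "r *\<^sub>R p = Quat (r * re p) (r * im_i p) (r * im_j p) (r * im_k p)"
instance
  by standard (simp_all add: scaleR_quat_def plus_quat_def algebra_simps)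

end

instantiation quat :: real_inner
begin

definition inner_quat where
  "p \<bullet> q = re p * re q + im_i p * im_i q + im_j p * im_j q + im_k p * im_k q"
definition norm_quat where
  "norm p = sqrt ((re p)\<^sup>2 + (im_i p)\<^sup>2 + (im_j p)\<^sup>2 + (im_k p)\<^sup>2)"
definition sgn_quat where "sgn p = p /\<^sub>R norm (p :: quat)"
definition dist_quat where "dist p q = norm (p - q :: quat)"
definition uniformity_quat where
  "(uniformity :: (quat \<times> quat) filter) = (INF e\<in>{0 <..}. principal {(p, q). dist p q < e})"
definition open_quat where
  "open (U :: quat set) \<longleftrightarrow> (\<forall>p\<in>U. eventually (\<lambda>(p', q). p' = p \<longrightarrow> q \<in> U) uniformity)"

instance
proof
  fix p q s :: quat and r :: real and U :: "quat set"
  show "p \<bullet> q = q \<bullet> p" "(p + q) \<bullet> s = p \<bullet> s + q \<bullet> s" "(r *\<^sub>R p) \<bullet> q = r * (p \<bullet> q)"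
    by (simp_all add: inner_quat_def scaleR_quat_def plus_quat_def algebra_simps)
  show "0 \<le> p \<bullet> p" by (simp add: inner_quat_def)
  show "(p \<bullet> p = 0) = (p = 0)"
    unfolding inner_quat_def quat_eq_iff zero_quat_def
    by (simp add: add_nonneg_eq_0_iff)
  show "norm p = sqrt (p \<bullet> p)" by (simp add: norm_quat_def inner_quat_def power2_eq_square)
qed (simp_all add: sgn_quat_def dist_quat_def uniformity_quat_def open_quat_def)

end

definition qcnj :: "quat \<Rightarrow> quat" where
  "qcnj q = Quat (re q) (- im_i q) (- im_j q) (- im_k q)"

instantiation quat :: real_normed_div_algebra
begin

definition inverse_quat where "inverse q = qcnj q /\<^sub>R (norm q)\<^sup>2"
definition divide_quat where "(p :: quat) div q = p * inverse q"

instance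
proof
  fix p q :: quat and r :: real
  have n: "(norm s)\<^sup>2 = re s * re s + im_i s * im_i s + im_j s * im_j s + im_k s * im_k s" for s :: quat
    by (simp add: norm_quat_def power2_eq_square)
  have qc: "q * qcnj q = (norm q)\<^sup>2 *\<^sub>R 1" "qcnj q * q = (norm q)\<^sup>2 *\<^sub>R 1"
    by (simp_all add: n quat_eq_iff times_quat_def qcnj_def scaleR_quat_def one_quat_def
          algebra_simps)
  have sc: "p * r *\<^sub>R q = r *\<^sub>R (p * q)" "r *\<^sub>R p * q = r *\<^sub>R (p * q)" for p q :: quat and r
    by (simp_all add: scaleR_quat_def times_quat_def algebra_simps)
  show "r *\<^sub>R p * q = r *\<^sub>R (p * q)" "p * r *\<^sub>R q = r *\<^sub>R (p * q)"
    by (rule sc)+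
  show "q \<noteq> 0 \<Longrightarrow> inverse q * q = 1" "q \<noteq> 0 \<Longrightarrow> q * inverse q = 1"
    by (simp_all add: inverse_quat_def sc qc)
  show "p div q = p * inverse q" by (rule divide_quat_def)
  show "inverse (0 :: quat) = 0"
    by (simp add: inverse_quat_def)
  have "(norm (p * q))\<^sup>2 = (norm p * norm q)\<^sup>2"
    unfolding power_mult_distrib n by (simp add: times_quat_def algebra_simps)
  then show "norm (p * q) = norm p * norm q" by (simp add: power2_eq_iff_nonneg)
qed

end

text \<open>The extended quaternions are \<^typ>\<open>quat option\<close>, with \<^const>\<open>None\<close> as the point at infinity.
  The value of \<open>qflt\<close> at infinity is the limit of \<open>(a + b q\<inverse>) (c + d q\<inverse>)\<inverse>\<close>.\<close>

definition qmat :: "quat \<Rightarrow> quat \<Rightarrow> quat \<Rightarrow> quat \<Rightarrow> quat^2^2" where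
  "qmat a b c d = vector [vector [a, b], vector [c, d]]"

definition qflt :: "quat \<Rightarrow> quat \<Rightarrow> quat \<Rightarrow> quat \<Rightarrow> quat option \<Rightarrow> quat option" where
  "qflt a b c d x = (case x of
       Some q \<Rightarrow> if c * q + d = 0 then None else Some ((a * q + b) * inverse (c * q + d))
     | None \<Rightarrow> if c = 0 then None else Some (a * inverse c))"

definition quat_Moebius :: "(quat option \<Rightarrow> quat option) set" where
  "quat_Moebius = {g. (\<exists>a b c d. invertible (qmat a b c d) \<and> g = qflt a b c d) \<and>
                      g ` (Some ` ball 0 1) = Some ` ball 0 1}"

text \<open>\<open>q \<mapsto> \<alpha> (q - q\<^sub>0) (1 - cnj q\<^sub>0 q)\<inverse> \<beta>\<inverse>\<close> on the extended quaternions, with the value at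
  infinity again given by the limit.\<close>

definition Moebius_form :: "quat \<Rightarrow> quat \<Rightarrow> quat \<Rightarrow> quat option \<Rightarrow> quat option" where
  "Moebius_form q\<^sub>0 \<alpha> \<beta> x = (case x of
       Some q \<Rightarrow> if 1 - qcnj q\<^sub>0 * q = 0 then None
                 else Some (\<alpha> * (q - q\<^sub>0) * inverse (1 - qcnj q\<^sub>0 * q) * inverse \<beta>)
     | None \<Rightarrow> if q\<^sub>0 = 0 then None else Some (\<alpha> * inverse (- qcnj q\<^sub>0) * inverse \<beta>))"

end

theory Submission
  imports Defs
begin

text \<open>
  A map \<open>g(q) = (a q + b)(c q + d)\<inverse>\<close> sends the open unit ball into itself iff
  \<open>|a q + b| < |c q + d|\<close> there, hence \<open>|a q + b| \<le> |c q + d|\<close> on the unit sphere by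
  continuity. Strict inequality cannot occur on the sphere: \<open>g\<close> is injective and already covers
  the ball with values at points of the ball. So \<open>|a q + b| = |c q + d|\<close> for \<open>|q| = 1\<close>.
  Squaring and comparing \<open>q\<close> with \<open>-q\<close> separates this into
  \<open>|a|\<^sup>2 + |b|\<^sup>2 = |c|\<^sup>2 + |d|\<^sup>2\<close> and \<open>cnj b a = cnj d c\<close>. Together with
  \<open>|b| < |d|\<close> (the strict inequality at \<open>q = 0\<close>) these force \<open>|a| = |d|\<close> and \<open>|b| = |c|\<close>:
  up to a real factor the matrix lies in \<open>Sp(1,1)\<close>. These relations say exactly that
  \<open>d\<inverse> c = - cnj q\<^sub>0\<close> for \<open>q\<^sub>0 = - a\<inverse> b\<close>, and the normal form follows by taking
  \<open>a\<close> out of the numerator on the left and \<open>d\<close> out of the denominator on the left.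

  As to uniqueness, \<open>q\<^sub>0\<close> is the zero of \<open>g\<close>. The factor
  \<open>u = (q - q\<^sub>0)(1 - cnj q\<^sub>0 q)\<inverse>\<close> takes every value on the unit sphere, so two forms
  with the same \<open>q\<^sub>0\<close> can agree only if \<open>\<alpha> u \<beta>\<inverse> = \<alpha>' u \<beta>'\<inverse>\<close> for all
  \<open>u\<close> with \<open>|u| = 1\<close>. Taking \<open>u = 1\<close> shows \<open>\<alpha>\<inverse> \<alpha>' = \<beta>\<inverse> \<beta>'\<close>, and then this unit
  quaternion commutes with every such \<open>u\<close>; the centre of the quaternions is real, so it is \<open>1\<close> or
  \<open>-1\<close>.
\<close>

section \<open>Quaternionic conjugation\<close>

lemma quat_norm_sq: "(norm (s :: quat))\<^sup>2 = (re s)\<^sup>2 + (im_i s)\<^sup>2 + (im_j s)\<^sup>2 + (im_k s)\<^sup>2"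
  by (simp add: norm_quat_def)

lemma qcnj_mult_self: "qcnj q * q = (norm q)\<^sup>2 *\<^sub>R 1"
  unfolding quat_norm_sq
  by (simp add: power2_eq_square quat_eq_iff times_quat_def qcnj_def scaleR_quat_def
      one_quat_def algebra_simps)

lemma norm_qcnj [simp]: "norm (qcnj q) = norm q"
  by (simp add: norm_quat_def qcnj_def)

lemma qcnj_zero_iff [simp]: "qcnj q = 0 \<longleftrightarrow> q = 0"
  by (metis norm_qcnj norm_eq_zero)

lemma qcnj_minus: "qcnj (- p) = - qcnj p"
  by (simp add: qcnj_def uminus_quat_def)

lemma qcnj_mult: "qcnj (p * q) = qcnj q * qcnj p"
  by (simp add: qcnj_def times_quat_def algebra_simps)

lemma qcnj_qcnj [simp]: "qcnj (qcnj p) = p"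
  by (simp add: qcnj_def)

lemma inner_mult_qcnj: "p \<bullet> (r * q) = (qcnj r * p) \<bullet> (q :: quat)"
  by (simp add: inner_quat_def qcnj_def times_quat_def algebra_simps)

text \<open>Testing commutation against \<open>i\<close> and \<open>j\<close> kills all imaginary parts, because each of the
  three imaginary units anticommutes with \<open>i\<close> or with \<open>j\<close>.\<close>

lemma unit_central_quat:
  assumes "\<And>u. norm u = 1 \<Longrightarrow> s * u = u * s" and "norm s = 1"
  shows "s = 1 \<or> s = (-1 :: quat)"
proof -
  have "s * Quat 0 1 0 0 = Quat 0 1 0 0 * s" "s * Quat 0 0 1 0 = Quat 0 0 1 0 * s"
    by (rule assms(1), simp add: norm_quat_def)+
  then have im: "im_i s = 0" "im_j s = 0" "im_k s = 0"
    by (auto simp: times_quat_def)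
  have "(re s)\<^sup>2 = 1"
    using quat_norm_sq[of s] assms(2) im by simp
  then show ?thesis
    using im by (auto simp: quat_eq_iff one_quat_def uminus_quat_def power2_eq_1_iff)
qed

section \<open>Maps that preserve the unit ball\<close>

text \<open>A left inverse of the matrix recovers \<open>(q, 1)\<close> from the homogeneous coordinates
  \<open>(w, 1) y\<close> of the image, where \<open>y\<close> is the denominator. The second coordinate determines
  \<open>y\<close> from \<open>w\<close>, and then the first one determines \<open>q\<close>.\<close>

lemma invertible_qmat_inj:
  assumes "invertible (qmat a b c d)"
    and q: "a * q + b = w * (c * q + d)" and p: "a * p + b = w * (c * p + d)"
  shows "p = q"
proof -
  obtain M where M: "M ** qmat a b c d = mat 1"
    using assms unfolding invertible_def by blast
  have E: "\<And>i j. (M ** qmat a b c d) $ i $ j = (if i = j then 1 else 0)"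
    using M by (simp add: mat_def)
  have m: "M$1$1 * a + M$1$2 * c = 1" "M$1$1 * b + M$1$2 * d = 0"
    "M$2$1 * a + M$2$2 * c = 0" "M$2$1 * b + M$2$2 * d = 1"
    using E[of 1 1] E[of 1 2] E[of 2 1] E[of 2 2]
    by (simp_all add: matrix_matrix_mult_def sum_2 qmat_def)
  have row: "(r * w + t) * (c * x + d) = (r * a + t * c) * x + (r * b + t * d)"
    if "a * x + b = w * (c * x + d)" for r t x
  proof -
    have "(r * w + t) * (c * x + d) = r * (w * (c * x + d)) + t * (c * x + d)"
      by (simp only: distrib_right mult.assoc)
    also have "\<dots> = r * (a * x + b) + t * (c * x + d)" by (simp only: that)
    also have "\<dots> = (r * a + t * c) * x + (r * b + t * d)" by (simp add: algebra_simps)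
    finally show ?thesis .
  qed
  have fst: "(M$1$1 * w + M$1$2) * (c * x + d) = x"
    and snd: "(M$2$1 * w + M$2$2) * (c * x + d) = 1" if "a * x + b = w * (c * x + d)" for x
    using row[OF that] by (simp_all add: m)
  have "M$2$1 * w + M$2$2 \<noteq> 0" using snd[OF q] by auto
  then have "c * q + d = c * p + d" using snd[OF q] snd[OF p] by (metis mult_left_cancel)
  then show "p = q" using fst[OF q] fst[OF p] by metis
qed

lemma ball_preserving_norm_less:
  assumes g: "qflt a b c d ` (Some ` ball 0 1) = Some ` ball 0 1" and q: "norm q < 1"
  shows "norm (a * q + b) < norm (c * q + d)"
proof -
  have "qflt a b c d (Some q) \<in> Some ` ball 0 1"
    using g q by (metis imageI mem_ball_0)
  then have nz: "c * q + d \<noteq> 0" and "norm ((a * q + b) * inverse (c * q + d)) < 1"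
    by (auto simp: qflt_def split: if_splits)
  then show ?thesis
    unfolding norm_mult norm_inverse by (simp add: field_simps)
qed

text \<open>If the norms differed at a point \<open>q\<close> of the sphere, \<open>g(q)\<close> would lie in the open ball and hence
  be attained a second time, inside the ball.\<close>

lemma ball_preserving_norm_eq:
  assumes inv: "invertible (qmat a b c d)"
    and g: "qflt a b c d ` (Some ` ball 0 1) = Some ` ball 0 1" and q: "norm q = 1"
  shows "norm (a * q + b) = norm (c * q + d)"
proof -
  have le: "norm (a * q + b) - norm (c * q + d) \<le> 0"
  proof (rule continuous_le_on_closure[of "ball 0 1" "\<lambda>q. norm (a * q + b) - norm (c * q + d)"])
    show "q \<in> closure (ball 0 1)" using q by simp
    show "norm (a * q + b) - norm (c * q + d) \<le> 0" if "q \<in> ball 0 1" for q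
      using ball_preserving_norm_less[OF g, of q] that by simp
  qed (intro continuous_intros)
  have "\<not> norm (a * q + b) < norm (c * q + d)"
  proof
    assume lt: "norm (a * q + b) < norm (c * q + d)"
    then have nz: "c * q + d \<noteq> 0" by auto
    define w where "w = (a * q + b) * inverse (c * q + d)"
    have "norm w < 1" using lt nz
      unfolding w_def norm_mult norm_inverse by (simp add: field_simps)
    then have "Some w \<in> qflt a b c d ` (Some ` ball 0 1)" using g by auto
    then obtain p where p: "norm p < 1" "qflt a b c d (Some p) = Some w" by auto
    then have nz': "c * p + d \<noteq> 0" and w': "w = (a * p + b) * inverse (c * p + d)"
      by (auto simp: qflt_def split: if_splits)
    have "p = q"
    proof (rule invertible_qmat_inj[OF inv])
      show "a * q + b = w * (c * q + d)" using nz by (simp add: w_def mult.assoc)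
      show "a * p + b = w * (c * p + d)" using nz' by (simp add: w' mult.assoc)
    qed
    then show False using p q by simp
  qed
  with le show ?thesis by simp
qed

lemma norm_affine_sq:
  "(norm (a * q + b))\<^sup>2 = (norm a)\<^sup>2 * (norm q)\<^sup>2 + (norm b)\<^sup>2 + 2 * ((qcnj a * b) \<bullet> (q :: quat))"
proof -
  have "(norm (a * q + b))\<^sup>2 = (norm (a * q))\<^sup>2 + (norm b)\<^sup>2 + 2 * (b \<bullet> (a * q))"
    unfolding power2_norm_eq_inner by (simp add: inner_add_left inner_add_right inner_commute)
  then show ?thesis by (simp add: norm_mult power_mult_distrib inner_mult_qcnj)
qed

text \<open>These relations say that the matrix is in \<open>Sp(1,1)\<close> up to the real scale
  \<open>|a|\<^sup>2 - |b|\<^sup>2\<close>, which is positive because \<open>g\<close> keeps the inside of the ball inside.\<close>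

lemma ball_preserving_coefficients:
  assumes inv: "invertible (qmat a b c d)"
    and g: "qflt a b c d ` (Some ` ball 0 1) = Some ` ball 0 1"
  shows "norm a = norm d" and "norm b < norm a" and "qcnj a * b = qcnj c * d"
proof -
  have sq: "(norm a)\<^sup>2 + (norm b)\<^sup>2 + 2 * ((qcnj a * b) \<bullet> q)
      = (norm c)\<^sup>2 + (norm d)\<^sup>2 + 2 * ((qcnj c * d) \<bullet> q)" if "norm q = 1" for q
    using ball_preserving_norm_eq[OF inv g that] norm_affine_sq[of a q b] norm_affine_sq[of c q d]
      that by simp
  have sum: "(norm a)\<^sup>2 + (norm b)\<^sup>2 = (norm c)\<^sup>2 + (norm d)\<^sup>2"
    using sq[of 1] sq[of "-1"] by simp
  show cross: "qcnj a * b = qcnj c * d"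
  proof (rule ccontr)
    assume ne: "qcnj a * b \<noteq> qcnj c * d"
    define x where "x = qcnj a * b - qcnj c * d"
    have "norm x \<noteq> 0" using ne by (simp add: x_def)
    \<comment> \<open>The linear parts agree on the whole sphere; test them in the direction of their difference.\<close>
    then have "x \<bullet> (x /\<^sub>R norm x) = 0"
      using sq[of "x /\<^sub>R norm x"] sum by (simp add: x_def inner_diff_left)
    then show False using \<open>norm x \<noteq> 0\<close> by simp
  qed
  have bd: "norm b < norm d" using ball_preserving_norm_less[OF g, of 0] by simp
  have "norm a * norm b = norm c * norm d"
    using arg_cong[OF cross, of norm] by (simp add: norm_mult)
  then have prod: "(norm a)\<^sup>2 * (norm b)\<^sup>2 = (norm c)\<^sup>2 * (norm d)\<^sup>2"
    by (metis power_mult_distrib)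
  \<comment> \<open>Equal sums and products: the pairs of squared norms are the roots of the same quadratic.\<close>
  have "((norm d)\<^sup>2 - (norm a)\<^sup>2) * ((norm d)\<^sup>2 - (norm b)\<^sup>2)
      = (norm d)\<^sup>2 * ((norm d)\<^sup>2 - ((norm a)\<^sup>2 + (norm b)\<^sup>2)) + (norm a)\<^sup>2 * (norm b)\<^sup>2"
    by (simp add: algebra_simps)
  also have "\<dots> = 0"
    unfolding sum prod by (simp add: algebra_simps)
  finally have "(norm d)\<^sup>2 = (norm a)\<^sup>2 \<or> (norm d)\<^sup>2 = (norm b)\<^sup>2" by simp
  then show ad: "norm a = norm d" using bd by (auto simp: power2_eq_iff_nonneg)
  show "norm b < norm a" using bd ad by simp
qed

section \<open>The normal form\<close>

text \<open>For \<open>q\<^sub>0 = - a\<inverse> b\<close> the numerator is \<open>a (q - q\<^sub>0)\<close>, and the coefficient relations turn the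
  denominator into \<open>d (1 - cnj q\<^sub>0 q)\<close>. The moduli of \<open>a\<close> and \<open>d\<close> cancel because they are equal.\<close>

lemma qflt_eq_Moebius_form:
  assumes ad: "norm a = norm d" and ba: "norm b < norm a" and cross: "qcnj a * b = qcnj c * d"
  shows "qflt a b c d = Moebius_form (- (inverse a * b)) (a /\<^sub>R norm a) (d /\<^sub>R norm d)"
proof -
  define p where "p = - (inverse a * b)"
  have a0: "a \<noteq> 0" using ba by auto
  then have d0: "d \<noteq> 0" using ad by auto
  have b: "b = - (a * p)" using a0 by (simp add: p_def mult.assoc[symmetric])
  have "qcnj c * d = - ((norm d)\<^sup>2 *\<^sub>R p)"
    using cross ad by (simp add: b mult.assoc[symmetric] qcnj_mult_self)
  then have "qcnj (qcnj c * d) = qcnj (- ((norm d)\<^sup>2 *\<^sub>R p))" by simp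
  then have "qcnj d * c = - ((norm d)\<^sup>2 *\<^sub>R qcnj p)"
    unfolding qcnj_mult qcnj_minus qcnj_qcnj by (simp add: qcnj_def scaleR_quat_def)
  also have "\<dots> = qcnj d * (- (d * qcnj p))"
    by (simp add: mult.assoc[symmetric] qcnj_mult_self)
  finally have c: "c = - (d * qcnj p)" using d0 by (metis mult_left_cancel qcnj_zero_iff)
  have num: "a * q + b = a * (q - p)" for q by (simp add: b algebra_simps)
  have den: "c * q + d = d * (1 - qcnj p * q)" for q by (simp add: c algebra_simps)
  have "qflt a b c d x = Moebius_form p (a /\<^sub>R norm a) (d /\<^sub>R norm d) x" for x
  proof (cases x)
    case None
    then show ?thesis
      using d0 a0 ad
      by (simp add: qflt_def Moebius_form_def c nonzero_inverse_mult_distrib mult.assoc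
          nonzero_inverse_minus_eq inverse_scaleR_distrib)
  next
    case (Some q)
    then show ?thesis
      using d0 a0 ad
      by (simp add: qflt_def Moebius_form_def num den nonzero_inverse_mult_distrib mult.assoc
          inverse_scaleR_distrib)
  qed
  then show ?thesis unfolding p_def by blast
qed

lemma one_minus_qcnj_self_nonzero:
  assumes "norm p < 1"
  shows "1 - qcnj p * p \<noteq> 0"
proof
  assume "1 - qcnj p * p = 0"
  then have "qcnj p * p = 1" by simp
  then have "norm (qcnj p * p) = 1" by simp
  then have "norm p * norm p = 1" by (simp add: norm_mult)
  then show False using mult_strict_mono'[of "norm p" 1 "norm p" 1] assms by simp
qed

text \<open>Solving \<open>(q - p)(1 - cnj p q)\<inverse> = u\<close> for \<open>q\<close> is a linear problem with solution
  \<open>(1 + u cnj p)\<inverse> (u + p)\<close>.\<close>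

lemma Moebius_factor_surj:
  assumes p: "norm p < 1" and u: "norm u = 1"
  obtains q where "1 - qcnj p * q \<noteq> 0" and "(q - p) * inverse (1 - qcnj p * q) = u"
proof -
  have nz: "1 + u * qcnj p \<noteq> 0"
  proof
    assume "1 + u * qcnj p = 0"
    then have "u * qcnj p = -1" by (simp add: add_eq_0_iff)
    then have "norm (u * qcnj p) = 1" by simp
    then show False using p u by (simp add: norm_mult)
  qed
  define q where "q = inverse (1 + u * qcnj p) * (u + p)"
  have "(1 + u * qcnj p) * q = u + p"
    using nz by (simp add: q_def mult.assoc[symmetric])
  then have eq: "q - p = u * (1 - qcnj p * q)" by (simp add: algebra_simps)
  have ne: "1 - qcnj p * q \<noteq> 0"
  proof
    assume z: "1 - qcnj p * q = 0"
    then have "q = p" using eq by simp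
    then show False using z one_minus_qcnj_self_nonzero[OF p] by simp
  qed
  show ?thesis
    by (rule that[OF ne]) (simp add: eq mult.assoc right_inverse[OF ne])
qed

lemma Moebius_form_unique:
  assumes p: "norm p < 1" and p': "norm p' < 1"
    and u: "norm \<alpha> = 1" "norm \<beta> = 1" "norm \<alpha>' = 1" "norm \<beta>' = 1"
    and eq: "Moebius_form p \<alpha> \<beta> = Moebius_form p' \<alpha>' \<beta>'"
  shows "p' = p \<and> (\<alpha>' = \<alpha> \<and> \<beta>' = \<beta> \<or> \<alpha>' = - \<alpha> \<and> \<beta>' = - \<beta>)"
proof -
  have nz: "\<alpha> \<noteq> 0" "\<beta> \<noteq> 0" "\<alpha>' \<noteq> 0" "\<beta>' \<noteq> 0" using u by auto
  have "Moebius_form p' \<alpha>' \<beta>' (Some p) = Some 0"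
    unfolding eq[symmetric] using one_minus_qcnj_self_nonzero[OF p] by (simp add: Moebius_form_def)
  then have pp: "p' = p"
    using nz by (auto simp: Moebius_form_def split: if_splits)
  have *: "\<alpha> * v * inverse \<beta> = \<alpha>' * v * inverse \<beta>'" if v: "norm v = 1" for v
  proof -
    obtain q where q: "1 - qcnj p * q \<noteq> 0" "(q - p) * inverse (1 - qcnj p * q) = v"
      using Moebius_factor_surj[OF p v] .
    have "\<alpha> * ((q - p) * inverse (1 - qcnj p * q)) * inverse \<beta>
        = \<alpha>' * ((q - p) * inverse (1 - qcnj p * q)) * inverse \<beta>'"
      using fun_cong[OF eq, of "Some q"] q(1) pp by (simp add: Moebius_form_def mult.assoc)
    then show ?thesis unfolding q(2) .
  qed
  define s where "s = inverse \<alpha> * \<alpha>'"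
  have \<alpha>': "\<alpha>' = \<alpha> * s" using nz by (simp add: s_def mult.assoc[symmetric])
  have ns: "norm s = 1" using u by (simp add: s_def norm_mult norm_inverse)
  have **: "v * (inverse \<beta> * \<beta>') = s * v" if "norm v = 1" for v
  proof -
    have "\<alpha> * (v * (inverse \<beta> * \<beta>')) = \<alpha> * v * inverse \<beta> * \<beta>'" by (simp add: mult.assoc)
    also have "\<dots> = \<alpha> * (s * v)"
      unfolding *[OF that] using nz by (simp add: \<alpha>' mult.assoc)
    finally show ?thesis using nz by simp
  qed
  have s: "inverse \<beta> * \<beta>' = s" using **[of 1] by simp
  then have \<beta>': "\<beta>' = \<beta> * s" using nz by (simp add: mult.assoc[symmetric] flip: s)
  have "s = 1 \<or> s = -1"
    by (rule unit_central_quat) (use ** s ns in simp_all)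
  then show ?thesis using pp \<alpha>' \<beta>' by auto
qed

theorem theorem1p7:
  fixes a b c d :: quat
  assumes "invertible (qmat a b c d)"
    and "qflt a b c d \<in> quat_Moebius"
  shows "a \<noteq> 0 \<and> d \<noteq> 0 \<and>
    (let q\<^sub>0 = - (inverse a * b); \<alpha> = a /\<^sub>R norm a; \<beta> = d /\<^sub>R norm d in
       q\<^sub>0 \<in> ball 0 1 \<and> \<alpha> \<in> sphere 0 1 \<and> \<beta> \<in> sphere 0 1 \<and>
       qflt a b c d = Moebius_form q\<^sub>0 \<alpha> \<beta> \<and>
       (\<forall>q\<^sub>0' \<in> ball 0 1. \<forall>\<alpha>' \<in> sphere 0 1. \<forall>\<beta>' \<in> sphere 0 1.
          qflt a b c d = Moebius_form q\<^sub>0' \<alpha>' \<beta>' \<longrightarrow>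
          q\<^sub>0' = q\<^sub>0 \<and> (\<alpha>' = \<alpha> \<and> \<beta>' = \<beta> \<or> \<alpha>' = - \<alpha> \<and> \<beta>' = - \<beta>)))"
proof -
  have "qflt a b c d ` (Some ` ball 0 1) = Some ` ball 0 1"
    using assms(2) by (simp add: quat_Moebius_def)
  note coeffs = ball_preserving_coefficients[OF assms(1) this]
  have a0: "a \<noteq> 0" using coeffs(2) by auto
  have d0: "d \<noteq> 0" using a0 coeffs(1) by auto
  have p: "norm (- (inverse a * b)) < 1"
    using coeffs(2) a0 unfolding norm_minus_cancel norm_mult norm_inverse
    by (simp add: field_simps)
  have \<alpha>: "norm (a /\<^sub>R norm a) = 1" and \<beta>: "norm (d /\<^sub>R norm d) = 1"
    using a0 d0 by simp_all
  note form = qflt_eq_Moebius_form[OF coeffs]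
  show ?thesis
    unfolding Let_def mem_ball_0 mem_sphere_0 form
  proof (intro conjI ballI impI)
    fix q\<^sub>0' \<alpha>' \<beta>' :: quat
    assume "q\<^sub>0' \<in> ball 0 1" "\<alpha>' \<in> sphere 0 1" "\<beta>' \<in> sphere 0 1"
      and eq: "Moebius_form (- (inverse a * b)) (a /\<^sub>R norm a) (d /\<^sub>R norm d) = Moebius_form q\<^sub>0' \<alpha>' \<beta>'"
    then have n: "norm q\<^sub>0' < 1" "norm \<alpha>' = 1" "norm \<beta>' = 1" by simp_all
    note uniq = Moebius_form_unique[OF p n(1) \<alpha> \<beta> n(2,3) eq]
    show "q\<^sub>0' = - (inverse a * b)" using uniq by (rule conjunct1)
    show "\<alpha>' = a /\<^sub>R norm a \<and> \<beta>' = d /\<^sub>R norm d \<or> \<alpha>' = - (a /\<^sub>R norm a) \<and> \<beta>' = - (d /\<^sub>R norm d)"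
      using uniq by (rule conjunct2)
  qed (fact a0 d0 p \<alpha> \<beta> refl)+
qed

end
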